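(* Let $a<b$ be real numbers and $q\in(0,1)$. Let $f:[a,b]\to\mathbb{R}$ be $q$-integrable over $[a,b]$, and further assume that $f$ is continuous at $a$. Then for all $x\in[a,b]$ the following inequality holds: $$\left|f(x)-\frac{1}{b-a}\int_a^b f(t)\,d_q^a t\right| \le (b-a)\left(\frac{x-a}{b-a}+\frac{1}{1+q}\right)\left\|D_q^a f\right\|_\infty^{(a,b]}.$$ Moreover, this bound is sharp whenever $x$ is not of the form $a+q^m(b-a)$ with $m\ge0$ an integer; that is, for every $x\in[a,b]$ that is not of this form, there exists a function $f:[a,b]\to\mathbb{R}$, $q$-integrable over $[a,b]$ and continuous at $a$, with $0<\|D_q^a f\|_\infty^{(a,b]}<\infty$, for which equality holds at $x$.
   Context: Let $f:[a,b]\to\mathbb{R}$ and $q\in(0,1)$. The (shifted) $q$-derivative of $f$ at $x\in(a,b]$ is $$D_q^a f(x)=\frac{f(x)-f(a+q(x-a))}{(1-q)(x-a)}.$$ The (shifted) $q$-integral is $$\int_a^b f(t)\,d_q^a t=(1-q)(b-a)\sum_{k=0}^\infty q^k f\big(a+q^k(b-a)\big),$$ and $f$ is called $q$-integrable over $[a,b]$ if this series converges. For a function $g$ defined on $(a,b]$, $\|g\|_\infty^{(a,b]}=\sup_{t\in(a,b]}|g(t)|\in[0,+\infty]$; if this is $+\infty$ the inequality is understood to hold trivially. *)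

theory Defs
  imports Complex_Main "HOL-Library.Extended_Nonnegative_Real"
begin

(* A function on [a,b] is represented by a total function real => real.  For 0 < q < 1, every
   notion below, taken at points of (a,b] or over [a,b], only looks at values on [a,b]. *)

definition q_deriv :: "real \<Rightarrow> real \<Rightarrow> (real \<Rightarrow> real) \<Rightarrow> real \<Rightarrow> real" where
  "q_deriv q a f x = (f x - f (a + q * (x - a))) / ((1 - q) * (x - a))"

definition q_integrable :: "real \<Rightarrow> real \<Rightarrow> real \<Rightarrow> (real \<Rightarrow> real) \<Rightarrow> bool" where
  "q_integrable q a b f \<longleftrightarrow> summable (\<lambda>k. q ^ k * f (a + q ^ k * (b - a)))"

definition q_integral :: "real \<Rightarrow> real \<Rightarrow> real \<Rightarrow> (real \<Rightarrow> real) \<Rightarrow> real" where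
  "q_integral q a b f = (1 - q) * (b - a) * (\<Sum>k. q ^ k * f (a + q ^ k * (b - a)))"

definition sup_norm_on :: "real set \<Rightarrow> (real \<Rightarrow> real) \<Rightarrow> ennreal" where
  "sup_norm_on S g = (SUP t\<in>S. ennreal \<bar>g t\<bar>)"

end

(* Iterating |f y - f (a + q (y - a))| \<le> M (1 - q) (y - a) along the q-orbit of y, which converges
   to a, telescopes to |f y - f a| \<le> M (y - a); the inequality follows by comparing both f x and
   the q-average of f with f a.  For sharpness, f t = a - t on the q-orbit of b and f t = t - a
   elsewhere satisfies |D_q f| = 1 because within (a,b] the map t |-> a + q (t - a) preserves both
   the orbit and its complement. *)

theory Submission
  imports Defs
begin

section \<open>The inequality: growth of f along q-orbits, then averaging\<close>

lemma q_orbit_mem: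
  fixes a b q y :: real
  assumes "0 < q" "q < 1" "y \<in> {a<..b}"
  shows "a + q ^ n * (y - a) \<in> {a<..b}"
proof -
  have "q ^ n \<le> 1" "0 < q ^ n"
    using assms by (auto intro: power_le_one)
  then have "q ^ n * (y - a) \<le> 1 * (y - a)" "0 < q ^ n * (y - a)"
    using assms by (auto intro!: mult_right_mono mult_pos_pos simp del: mult_1)
  then show ?thesis using assms by auto
qed

lemma abs_diff_q_orbit_le:
  fixes a b q M y :: real and f :: "real \<Rightarrow> real"
  assumes q: "0 < q" "q < 1"
    and M: "\<And>t. t \<in> {a<..b} \<Longrightarrow> \<bar>q_deriv q a f t\<bar> \<le> M"
    and y: "y \<in> {a<..b}"
  shows "\<bar>f y - f (a + q ^ n * (y - a))\<bar> \<le> M * (y - a) * (1 - q ^ n)"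
proof (induction n)
  case (Suc n)
  let ?z = "a + q ^ n * (y - a)"
  have "\<bar>f ?z - f (a + q * (?z - a))\<bar> / ((1 - q) * (?z - a)) \<le> M"
    using M[OF q_orbit_mem[OF q y, of n]] q q_orbit_mem[OF q y, of n] y
    by (simp add: q_deriv_def abs_mult)
  moreover have "0 < (1 - q) * (?z - a)"
    using q q_orbit_mem[OF q y, of n] by simp
  ultimately have "\<bar>f ?z - f (a + q * (?z - a))\<bar> \<le> M * ((1 - q) * (?z - a))"
    by (simp only: pos_divide_le_eq)
  moreover have "a + q * (?z - a) = a + q ^ Suc n * (y - a)"
    by simp
  \<comment> \<open>The step length (1 - q) q^n (y - a) is written as a difference of consecutive
    powers, so that the bounds telescope to the factor 1 - q^n.\<close>
  ultimately have "\<bar>f ?z - f (a + q ^ Suc n * (y - a))\<bar> \<le> M * (y - a) * (q ^ n - q ^ Suc n)"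
    by (simp add: algebra_simps)
  then have "\<bar>f y - f (a + q ^ Suc n * (y - a))\<bar>
      \<le> M * (y - a) * (1 - q ^ n) + M * (y - a) * (q ^ n - q ^ Suc n)"
    using Suc.IH by linarith
  also have "\<dots> = M * (y - a) * (1 - q ^ Suc n)"
    by (simp add: algebra_simps)
  finally show ?case .
qed simp

lemma abs_diff_left_end_le:
  fixes a b q M y :: real and f :: "real \<Rightarrow> real"
  assumes q: "0 < q" "q < 1"
    and M: "\<And>t. t \<in> {a<..b} \<Longrightarrow> \<bar>q_deriv q a f t\<bar> \<le> M"
    and cont: "continuous (at a within {a..b}) f"
    and y: "y \<in> {a..b}"
  shows "\<bar>f y - f a\<bar> \<le> M * (y - a)"
proof (cases "y = a")
  case False
  then have y': "y \<in> {a<..b}" using y by simp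
  have pow: "(\<lambda>n. q ^ n) \<longlonglongrightarrow> 0"
    using q by (intro LIMSEQ_realpow_zero) auto
  have "(\<lambda>n. a + q ^ n * (y - a)) \<longlonglongrightarrow> a + 0 * (y - a)"
    by (intro tendsto_intros pow)
  then have orbit: "(\<lambda>n. a + q ^ n * (y - a)) \<longlonglongrightarrow> a" by simp
  have "(\<lambda>n. f (a + q ^ n * (y - a))) \<longlonglongrightarrow> f a"
    using cont unfolding continuous_within
  proof (rule filterlim_compose)
    \<comment> \<open>The filter \<open>at a within {a..b}\<close> is punctured at a, so the orbit
      has to avoid a itself. This is why y = a is split off as a separate case.\<close>
    have "\<forall>\<^sub>F n in sequentially. a + q ^ n * (y - a) \<in> {a..b} \<and> a + q ^ n * (y - a) \<noteq> a"
      using q_orbit_mem[OF q y'] q False by (auto simp: less_imp_le)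
    then show "filterlim (\<lambda>n. a + q ^ n * (y - a)) (at a within {a..b}) sequentially"
      using orbit by (simp only: filterlim_at)
  qed
  then have "(\<lambda>n. \<bar>f y - f (a + q ^ n * (y - a))\<bar>) \<longlonglongrightarrow> \<bar>f y - f a\<bar>"
    by (intro tendsto_intros)
  moreover have "(\<lambda>n. M * (y - a) * (1 - q ^ n)) \<longlonglongrightarrow> M * (y - a) * (1 - 0)"
    by (intro tendsto_intros pow)
  ultimately have "\<bar>f y - f a\<bar> \<le> M * (y - a) * (1 - 0)"
    using abs_diff_q_orbit_le[OF q M y'] by (intro LIMSEQ_le) auto
  then show ?thesis by simp
qed simp

text \<open>For c = s (b - a), the factor \<open>q ^ k * c\<close> is the value of the linear
  function t |-> s (t - a) at the k-th orbit point of b, so up to the prefactor 1 - q the series is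
  the q-average of that function. The slope s = M serves the upper bound and s = -1 the extremal
  function.\<close>

lemma q_integral_identity_sums:
  fixes q c :: real
  assumes "0 < q" "q < 1"
  shows "(\<lambda>k. q ^ k * (q ^ k * c)) sums (c / (1 - q\<^sup>2))"
proof -
  have "q\<^sup>2 < 1" using assms by (simp add: power_less_one_iff)
  then have "(\<lambda>k. (q\<^sup>2) ^ k * c) sums (1 / (1 - q\<^sup>2) * c)"
    by (intro sums_mult2 geometric_sums) simp
  moreover have "(q\<^sup>2) ^ k * c = q ^ k * (q ^ k * c)" for k
    by (simp add: power_mult_distrib power2_eq_square)
  ultimately show ?thesis by simp
qed

text \<open>Source of the constant 1/(1 + q): the prefactor 1 - q of the q-average cancels one
  factor of 1 - q^2.\<close>

lemma one_minus_over_one_minus_square: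
  fixes q c :: real
  assumes "0 < q" "q < 1"
  shows "(1 - q) * (c / (1 - q\<^sup>2)) = c / (1 + q)"
proof -
  have "1 - q\<^sup>2 = (1 - q) * (1 + q)"
    by (simp add: power2_eq_square algebra_simps)
  then show ?thesis using assms by simp
qed

lemma q_average_eq:
  assumes "a < b"
  shows "1 / (b - a) * q_integral q a b f = (1 - q) * (\<Sum>k. q ^ k * f (a + q ^ k * (b - a)))"
  using assms by (simp add: q_integral_def)

text \<open>The weights (1 - q) q^k sum to 1, so c is its own q-average and the pointwise bound can
  be averaged termwise. The lemma is applied with c = f a.\<close>

lemma abs_q_average_diff_le:
  fixes a b q M :: real and f :: "real \<Rightarrow> real"
  assumes ab: "a < b" and q: "0 < q" "q < 1"
    and int: "q_integrable q a b f"
    and M: "\<And>y. y \<in> {a<..b} \<Longrightarrow> \<bar>f y - c\<bar> \<le> M * (y - a)"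
  shows "\<bar>c - 1 / (b - a) * q_integral q a b f\<bar> \<le> M * (b - a) / (1 + q)"
proof -
  let ?F = "\<lambda>k. q ^ k * f (a + q ^ k * (b - a))"
  have g: "(\<lambda>k. q ^ k * c) sums (1 / (1 - q) * c)"
    using q by (intro sums_mult2 geometric_sums) auto
  have F: "?F sums (\<Sum>k. ?F k)"
    using int by (simp add: q_integrable_def summable_sums)
  have d: "(\<lambda>k. q ^ k * c - ?F k) sums (1 / (1 - q) * c - (\<Sum>k. ?F k))"
    by (rule sums_diff[OF g F])
  have bound: "norm (q ^ k * c - ?F k) \<le> q ^ k * (q ^ k * (M * (b - a)))" for k
  proof -
    have "\<bar>f (a + q ^ k * (b - a)) - c\<bar> \<le> M * (q ^ k * (b - a))"
      using M[OF q_orbit_mem[OF q, of b a b k]] ab by simp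
    moreover have "\<bar>q ^ k * c - ?F k\<bar> = q ^ k * \<bar>f (a + q ^ k * (b - a)) - c\<bar>"
      using q by (simp add: abs_mult abs_minus_commute flip: right_diff_distrib)
    ultimately show ?thesis
      using q by (simp add: mult_left_mono mult.left_commute)
  qed
  note s = q_integral_identity_sums[OF q, of "M * (b - a)"]
  have "\<bar>1 / (1 - q) * c - (\<Sum>k. ?F k)\<bar> \<le> M * (b - a) / (1 - q\<^sup>2)"
    using norm_suminf_le[OF bound sums_summable[OF s]] sums_unique[OF d] sums_unique[OF s] by simp
  then have "(1 - q) * \<bar>1 / (1 - q) * c - (\<Sum>k. ?F k)\<bar> \<le> (1 - q) * (M * (b - a) / (1 - q\<^sup>2))"
    using q by (intro mult_left_mono) auto
  moreover have "(1 - q) * \<bar>1 / (1 - q) * c - (\<Sum>k. ?F k)\<bar> = \<bar>(1 - q) * (1 / (1 - q) * c - (\<Sum>k. ?F k))\<bar>"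
    using q by (simp add: abs_mult)
  moreover have "(1 - q) * (1 / (1 - q) * c - (\<Sum>k. ?F k)) = c - (1 - q) * (\<Sum>k. ?F k)"
    using q by (simp add: right_diff_distrib)
  ultimately show ?thesis
    unfolding q_average_eq[OF ab] one_minus_over_one_minus_square[OF q] by simp
qed

lemma q_ostrowski:
  fixes a b q x :: real and f :: "real \<Rightarrow> real"
  assumes ab: "a < b" and q: "0 < q" "q < 1"
    and int: "q_integrable q a b f"
    and cont: "continuous (at a within {a..b}) f"
    and x: "x \<in> {a..b}"
  shows "ennreal \<bar>f x - 1 / (b - a) * q_integral q a b f\<bar>
           \<le> ennreal ((b - a) * ((x - a) / (b - a) + 1 / (1 + q)))
               * sup_norm_on {a<..b} (q_deriv q a f)"
proof (cases "sup_norm_on {a<..b} (q_deriv q a f)")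
  case (real M)
  have M: "\<bar>q_deriv q a f t\<bar> \<le> M" if "t \<in> {a<..b}" for t
  proof -
    have "ennreal \<bar>q_deriv q a f t\<bar> \<le> ennreal M"
      using that unfolding real(2)[symmetric] sup_norm_on_def by (rule SUP_upper)
    then show ?thesis using real(1) by simp
  qed
  note lip = abs_diff_left_end_le[OF q M cont]
  have "\<bar>f a - 1 / (b - a) * q_integral q a b f\<bar> \<le> M * (b - a) / (1 + q)"
    by (rule abs_q_average_diff_le[OF ab q int]) (auto intro: lip)
  then have "\<bar>f x - 1 / (b - a) * q_integral q a b f\<bar> \<le> M * (x - a) + M * (b - a) / (1 + q)"
    using lip[OF _ x] by linarith
  also have "\<dots> = (b - a) * ((x - a) / (b - a) + 1 / (1 + q)) * M"
    using ab by (simp add: distrib_left distrib_right mult.commute)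
  finally show ?thesis
    unfolding real(2) using real(1) ab q x
    by (subst ennreal_mult[symmetric]) (auto intro!: ennreal_leI)
next
  case top
  \<comment> \<open>In \<open>ennreal\<close> the product of 0 and \<open>top\<close> is 0, so the
    case of infinite norm is trivial only because the constant is strictly positive, even at x =
    a.\<close>
  have "0 < (b - a) * ((x - a) / (b - a) + 1 / (1 + q))"
    using ab q x by (intro mult_pos_pos add_nonneg_pos) auto
  then show ?thesis unfolding top by (subst ennreal_mult_top) auto
qed

section \<open>Sharpness: the extremal function\<close>

definition q_orbit :: "real \<Rightarrow> real \<Rightarrow> real \<Rightarrow> real set" where
  "q_orbit q a b = range (\<lambda>m::nat. a + q ^ m * (b - a))"

text \<open>The q-integral samples only the orbit of b, where the slope is -1, while a point x off
  the orbit sees slope +1. The value at x and the average thus get opposite signs, and nothing is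
  lost in the triangle inequality.\<close>

definition q_extremal :: "real \<Rightarrow> real \<Rightarrow> real \<Rightarrow> real \<Rightarrow> real" where
  "q_extremal q a b t = (if t \<in> q_orbit q a b then a - t else t - a)"

lemma q_orbit_contract_iff:
  fixes a b q t :: real
  assumes q: "0 < q" "q < 1" and t: "t \<in> {a<..b}"
  shows "a + q * (t - a) \<in> q_orbit q a b \<longleftrightarrow> t \<in> q_orbit q a b"
proof
  assume "a + q * (t - a) \<in> q_orbit q a b"
  then obtain m where "a + q * (t - a) = a + q ^ m * (b - a)"
    unfolding q_orbit_def by blast
  then have m: "q * (t - a) = q ^ m * (b - a)"
    by (simp only: add_left_cancel)
  show "t \<in> q_orbit q a b"
  proof (cases m)
    \<comment> \<open>Exponent 0 would mean a + q (t - a) = b, but this point lies strictly below t,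
      and t \<le> b.\<close>
    case 0
    have "q * (t - a) < 1 * (t - a)"
      using q t by (intro mult_strict_right_mono) auto
    then show ?thesis using 0 m t by auto
  next
    case (Suc k)
    then have "t = a + q ^ k * (b - a)" using m q by (simp add: mult.assoc)
    then show ?thesis unfolding q_orbit_def by blast
  qed
next
  assume "t \<in> q_orbit q a b"
  then obtain m where "t = a + q ^ m * (b - a)" by (auto simp: q_orbit_def)
  then have "a + q * (t - a) = a + q ^ Suc m * (b - a)" by simp
  then show "a + q * (t - a) \<in> q_orbit q a b" unfolding q_orbit_def by blast
qed

lemma abs_q_deriv_q_extremal:
  assumes "0 < q" "q < 1" "t \<in> {a<..b}"
  shows "\<bar>q_deriv q a (q_extremal q a b) t\<bar> = 1"
proof -
  have nz: "(1 - q) * (t - a) \<noteq> 0" using assms by simp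
  have "q_extremal q a b t - q_extremal q a b (a + q * (t - a))
      = (if t \<in> q_orbit q a b then - ((1 - q) * (t - a)) else (1 - q) * (t - a))"
    unfolding q_extremal_def q_orbit_contract_iff[OF assms] by (simp add: algebra_simps)
  then show ?thesis
    unfolding q_deriv_def using nz by (auto simp del: mult_eq_0_iff)
qed

lemma sup_norm_on_q_deriv_q_extremal:
  assumes "a < b" "0 < q" "q < 1"
  shows "sup_norm_on {a<..b} (q_deriv q a (q_extremal q a b)) = 1"
proof -
  have "sup_norm_on {a<..b} (q_deriv q a (q_extremal q a b)) = (SUP t\<in>{a<..b}. 1)"
    unfolding sup_norm_on_def using assms
    by (intro SUP_cong) (auto simp: abs_q_deriv_q_extremal)
  \<comment> \<open>The interval is nonempty because a < b; over an empty set the supremum in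
    \<open>ennreal\<close> would be 0 instead of 1.\<close>
  then show ?thesis using assms by simp
qed

text \<open>Both branches vanish at a and have absolute value |t - a|, so it does not matter how
  orbit points and other points interleave near a.\<close>

lemma continuous_q_extremal: "continuous (at a within S) (q_extremal q a b)"
proof -
  have "q_extremal q a b a = 0" by (simp add: q_extremal_def)
  moreover have "(q_extremal q a b \<longlongrightarrow> 0) (at a within S)"
  proof (rule tendsto_rabs_zero_cancel)
    have abs: "\<bar>q_extremal q a b t\<bar> = \<bar>t - a\<bar>" for t
      by (simp add: q_extremal_def abs_minus_commute)
    have "((\<lambda>t. \<bar>t - a\<bar>) \<longlongrightarrow> \<bar>a - a\<bar>) (at a within S)"
      by (intro tendsto_intros)
    then show "((\<lambda>t. \<bar>q_extremal q a b t\<bar>) \<longlongrightarrow> 0) (at a within S)"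
      by (simp add: abs)
  qed
  ultimately show ?thesis by (simp add: continuous_within)
qed

lemma q_extremal_sums:
  fixes a b q :: real
  assumes "0 < q" "q < 1"
  shows "(\<lambda>k. q ^ k * q_extremal q a b (a + q ^ k * (b - a))) sums (- (b - a) / (1 - q\<^sup>2))"
proof -
  have "q_extremal q a b (a + q ^ k * (b - a)) = q ^ k * (- (b - a))" for k
    by (auto simp: q_extremal_def q_orbit_def algebra_simps)
  then show ?thesis
    using q_integral_identity_sums[OF assms, of "- (b - a)"] by (simp only:)
qed

lemma q_extremal_deviation:
  fixes a b q x :: real
  assumes ab: "a < b" and q: "0 < q" "q < 1" and x: "a \<le> x" "x \<notin> q_orbit q a b"
  shows "\<bar>q_extremal q a b x - 1 / (b - a) * q_integral q a b (q_extremal q a b)\<bar>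
           = (b - a) * ((x - a) / (b - a) + 1 / (1 + q))"
proof -
  have "1 / (b - a) * q_integral q a b (q_extremal q a b) = (1 - q) * (- (b - a) / (1 - q\<^sup>2))"
    unfolding q_average_eq[OF ab] sums_unique[OF q_extremal_sums[OF q], symmetric] ..
  also have "\<dots> = - (b - a) / (1 + q)"
    by (rule one_minus_over_one_minus_square[OF q])
  finally have avg: "1 / (b - a) * q_integral q a b (q_extremal q a b) = - ((b - a) / (1 + q))"
    by (simp only: minus_divide_left)
  have "0 \<le> (b - a) / (1 + q)" using ab q by simp
  then have "\<bar>q_extremal q a b x - 1 / (b - a) * q_integral q a b (q_extremal q a b)\<bar>
      = (x - a) + (b - a) / (1 + q)"
    unfolding avg using x by (simp only: q_extremal_def if_False)
  also have "\<dots> = (b - a) * ((x - a) / (b - a) + 1 / (1 + q))"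
    using ab by (simp add: distrib_left)
  finally show ?thesis .
qed

theorem theorem14:
  fixes a b q :: real
  assumes "a < b" and "0 < q" and "q < 1"
  shows "(\<forall>f. q_integrable q a b f \<and> continuous (at a within {a..b}) f \<longrightarrow>
            (\<forall>x\<in>{a..b}.
               ennreal \<bar>f x - 1 / (b - a) * q_integral q a b f\<bar>
                 \<le> ennreal ((b - a) * ((x - a) / (b - a) + 1 / (1 + q)))
                     * sup_norm_on {a<..b} (q_deriv q a f))) \<and>
         (\<forall>x\<in>{a..b}. (\<nexists>m::nat. x = a + q ^ m * (b - a)) \<longrightarrow>
            (\<exists>f. q_integrable q a b f \<and> continuous (at a within {a..b}) f \<and>
                 0 < sup_norm_on {a<..b} (q_deriv q a f) \<and>
                 sup_norm_on {a<..b} (q_deriv q a f) < top \<and>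
                 ennreal \<bar>f x - 1 / (b - a) * q_integral q a b f\<bar>
                   = ennreal ((b - a) * ((x - a) / (b - a) + 1 / (1 + q)))
                       * sup_norm_on {a<..b} (q_deriv q a f)))"
proof (intro conjI allI impI ballI, goal_cases)
  case (1 f x)
  then show ?case using assms by (intro q_ostrowski) auto
next
  case (2 x)
  have "q_integrable q a b (q_extremal q a b)"
    unfolding q_integrable_def using q_extremal_sums[OF assms(2,3)] by (rule sums_summable)
  moreover have "x \<notin> q_orbit q a b" "a \<le> x"
    using 2 by (auto simp: q_orbit_def)
  \<comment> \<open>The norm equals 1, which gives positivity and finiteness and reduces the
    equation to the computed deviation.\<close>
  ultimately show ?case
    using continuous_q_extremal sup_norm_on_q_deriv_q_extremal[OF assms] q_extremal_deviation[OF assms]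
    by (intro exI[of _ "q_extremal q a b"]) (simp del: times_divide_eq_left)
qed

end
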